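(* Let $\Lambda$ be a finite simplicial graph. If $\Gamma=\{v\}\ast\Lambda$ is the cone over $\Lambda$, then $BB_\Gamma\cong A_\Lambda$.
   Context: All graphs are finite simplicial graphs. The cone $\{v\}\ast\Lambda$ is the graph obtained from $\Lambda$ by adding one new vertex $v$ and an edge from $v$ to every vertex of $\Lambda$. The right-angled Artin group on a graph $\Gamma$ is $A_\Gamma=\langle V(\Gamma)\mid [v,w] \text{ whenever } (v,w)\in E(\Gamma)\rangle$, and the Bestvina--Brady group $BB_\Gamma$ is the kernel of the homomorphism $A_\Gamma\to\mathbb Z$ sending every vertex generator to $1$. *)

theory Defs
  imports "HOL-Algebra.Elementary_Groups" "Graph_Theory.Pair_Digraph"
begin

text \<open>A word over the alphabet \<open>S\<close> and its formal inverses is a list of signed letters: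
  \<open>(x, True)\<close> stands for \<open>x\<close> and \<open>(x, False)\<close> for \<open>x\<close> inverse.\<close>

type_synonym 'a gword = "('a \<times> bool) list"

definition gwords :: "'a set \<Rightarrow> 'a gword set" where
  "gwords S = lists (S \<times> UNIV)"

text \<open>Two words are equal in the group \<open>\<langle>S | R\<rangle>\<close> iff one can be turned into the other by finitely
  many insertions and deletions of inverse pairs of letters and of relators.\<close>

inductive pres_eq :: "'a set \<Rightarrow> 'a gword set \<Rightarrow> 'a gword \<Rightarrow> 'a gword \<Rightarrow> bool"
  for S R where
  pres_refl: "w \<in> gwords S \<Longrightarrow> pres_eq S R w w"
| pres_sym: "pres_eq S R u w \<Longrightarrow> pres_eq S R w u"
| pres_trans: "pres_eq S R u w \<Longrightarrow> pres_eq S R w z \<Longrightarrow> pres_eq S R u z"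
| pres_cancel: "u \<in> gwords S \<Longrightarrow> w \<in> gwords S \<Longrightarrow> x \<in> S \<Longrightarrow>
    pres_eq S R (u @ [(x, b), (x, \<not> b)] @ w) (u @ w)"
| pres_relator: "u \<in> gwords S \<Longrightarrow> w \<in> gwords S \<Longrightarrow> r \<in> R \<Longrightarrow> r \<in> gwords S \<Longrightarrow>
    pres_eq S R (u @ r @ w) (u @ w)"

definition pres_class :: "'a set \<Rightarrow> 'a gword set \<Rightarrow> 'a gword \<Rightarrow> 'a gword set" where
  "pres_class S R w = {w'. pres_eq S R w w'}"

definition presented_group :: "'a set \<Rightarrow> 'a gword set \<Rightarrow> 'a gword set monoid" where
  "presented_group S R =
    \<lparr>carrier = pres_class S R ` gwords S,
     monoid.mult = (\<lambda>A B. \<Union>a\<in>A. \<Union>b\<in>B. pres_class S R (a @ b)),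
     one = pres_class S R []\<rparr>"

definition pres_gen :: "'a set \<Rightarrow> 'a gword set \<Rightarrow> 'a \<Rightarrow> 'a gword set" where
  "pres_gen S R x = pres_class S R [(x, True)]"

text \<open>The value of a word in a group \<open>G\<close> under an assignment \<open>f\<close> of its letters, and the
  map on a presented group induced by it. The latter is only meaningful if all relators evaluate to
  the identity, so that evaluation is constant on each class.\<close>

definition word_eval :: "('g, 'm) monoid_scheme \<Rightarrow> ('a \<Rightarrow> 'g) \<Rightarrow> 'a gword \<Rightarrow> 'g" where
  "word_eval G f w =
    foldr (\<lambda>(x, b) y. (if b then f x else inv\<^bsub>G\<^esub> (f x)) \<otimes>\<^bsub>G\<^esub> y) w \<one>\<^bsub>G\<^esub>"

definition pres_lift :: "('g, 'm) monoid_scheme \<Rightarrow> ('a \<Rightarrow> 'g) \<Rightarrow> 'a gword set \<Rightarrow> 'g" where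
  "pres_lift G f A = the_elem (word_eval G f ` A)"

lemma gwords_simps [simp]:
  "[] \<in> gwords S"
  "(p # w) \<in> gwords S \<longleftrightarrow> fst p \<in> S \<and> w \<in> gwords S"
  "(u @ w) \<in> gwords S \<longleftrightarrow> u \<in> gwords S \<and> w \<in> gwords S"
  by (auto simp: gwords_def mem_Times_iff)

lemma pres_eq_gwords:
  assumes "pres_eq S R u w"
  shows "u \<in> gwords S" "w \<in> gwords S"
  using assms by (induction) auto

lemma pres_eq_append_left:
  "pres_eq S R u w \<Longrightarrow> z \<in> gwords S \<Longrightarrow> pres_eq S R (z @ u) (z @ w)"
proof (induction rule: pres_eq.induct)
  case (pres_cancel u w x b)
  then show ?case using pres_eq.pres_cancel[of "z @ u" S w x R b] by simp
next
  case (pres_relator u w r)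
  then show ?case using pres_eq.pres_relator[of "z @ u" S w r R] by simp
qed (auto intro: pres_eq.intros)

lemma pres_eq_append_right:
  "pres_eq S R u w \<Longrightarrow> z \<in> gwords S \<Longrightarrow> pres_eq S R (u @ z) (w @ z)"
proof (induction rule: pres_eq.induct)
  case (pres_cancel u w x b)
  then show ?case using pres_eq.pres_cancel[of u S "w @ z" x R b] by simp
next
  case (pres_relator u w r)
  then show ?case using pres_eq.pres_relator[of u S "w @ z" r R] by simp
qed (auto intro: pres_eq.intros)

lemma pres_eq_append:
  "pres_eq S R u u' \<Longrightarrow> pres_eq S R w w' \<Longrightarrow> pres_eq S R (u @ w) (u' @ w')"
  by (rule pres_eq.pres_trans[OF pres_eq_append_right pres_eq_append_left])
    (auto dest: pres_eq_gwords)

lemma pres_class_self: "w \<in> gwords S \<Longrightarrow> w \<in> pres_class S R w"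
  by (simp add: pres_class_def pres_eq.pres_refl)

lemma pres_class_eq_iff:
  "u \<in> gwords S \<Longrightarrow> pres_class S R u = pres_class S R w \<longleftrightarrow> pres_eq S R u w"
proof
  assume "u \<in> gwords S" "pres_class S R u = pres_class S R w"
  then have "u \<in> pres_class S R w" using pres_class_self by blast
  then show "pres_eq S R u w" by (simp add: pres_class_def pres_eq.pres_sym)
next
  assume uw: "pres_eq S R u w"
  have "pres_eq S R u z \<longleftrightarrow> pres_eq S R w z" for z
    using pres_eq.pres_trans[OF uw] pres_eq.pres_trans[OF pres_eq.pres_sym[OF uw]] by blast
  then show "pres_class S R u = pres_class S R w" by (simp add: pres_class_def)
qed

lemma carrier_presented_group [simp]:
  "carrier (presented_group S R) = pres_class S R ` gwords S"
  by (simp add: presented_group_def)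

lemma one_presented_group [simp]: "\<one>\<^bsub>presented_group S R\<^esub> = pres_class S R []"
  by (simp add: presented_group_def)

lemma mult_presented_group [simp]:
  assumes "u \<in> gwords S" "w \<in> gwords S"
  shows "pres_class S R u \<otimes>\<^bsub>presented_group S R\<^esub> pres_class S R w = pres_class S R (u @ w)"
proof -
  have eq: "pres_class S R (a @ b) = pres_class S R (u @ w)"
    if "a \<in> pres_class S R u" "b \<in> pres_class S R w" for a b
  proof -
    have "pres_eq S R u a" "pres_eq S R w b" using that by (simp_all add: pres_class_def)
    then have "pres_eq S R (u @ w) (a @ b)" by (rule pres_eq_append)
    moreover have "u @ w \<in> gwords S" using assms by simp
    ultimately show ?thesis using pres_class_eq_iff by metis
  qed
  have "(\<Union>a\<in>pres_class S R u. \<Union>b\<in>pres_class S R w. pres_class S R (a @ b))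
      = (\<Union>a\<in>pres_class S R u. \<Union>b\<in>pres_class S R w. pres_class S R (u @ w))"
    by (intro SUP_cong refl eq)
  also have "\<dots> = pres_class S R (u @ w)"
    using pres_class_self[OF assms(1)] pres_class_self[OF assms(2)] by auto
  finally show ?thesis by (simp add: presented_group_def)
qed

lemma pres_eq_left_inverse:
  "w \<in> gwords S \<Longrightarrow> \<exists>w'\<in>gwords S. pres_eq S R (w' @ w) []"
proof (induction w)
  case Nil
  have "pres_eq S R ([] @ []) []" by (simp add: pres_eq.pres_refl)
  then show ?case using gwords_simps(1) by blast
next
  case (Cons p w)
  obtain x b where p: "p = (x, b)" by fastforce
  from Cons obtain w' where w': "w' \<in> gwords S" "pres_eq S R (w' @ w) []" by auto
  have "pres_eq S R ((w' @ [(x, \<not> b)]) @ p # w) (w' @ w)"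
    using pres_eq.pres_cancel[of w' S w x R "\<not> b"] Cons.prems w' p by simp
  then have "pres_eq S R ((w' @ [(x, \<not> b)]) @ p # w) []"
    using w' by (blast intro: pres_eq.pres_trans)
  moreover have "w' @ [(x, \<not> b)] \<in> gwords S" using w' Cons.prems p by simp
  ultimately show ?case by blast
qed

lemma group_presented_group: "group (presented_group S R)"
proof (rule groupI)
  let ?P = "presented_group S R"
  show "\<one>\<^bsub>?P\<^esub> \<in> carrier ?P"
    by simp
  fix A assume "A \<in> carrier ?P"
  then obtain u where u: "u \<in> gwords S" and A: "A = pres_class S R u" by auto
  show "\<one>\<^bsub>?P\<^esub> \<otimes>\<^bsub>?P\<^esub> A = A"
    unfolding A one_presented_group by (simp add: u)
  obtain u' where u': "u' \<in> gwords S" "pres_eq S R (u' @ u) []"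
    using pres_eq_left_inverse[OF u] by blast
  have "pres_class S R u' \<otimes>\<^bsub>?P\<^esub> A = \<one>\<^bsub>?P\<^esub>"
    unfolding A one_presented_group mult_presented_group[OF u'(1) u]
    using u u' by (simp add: pres_class_eq_iff)
  moreover have "pres_class S R u' \<in> carrier ?P" using u' by simp
  ultimately show "\<exists>B\<in>carrier ?P. B \<otimes>\<^bsub>?P\<^esub> A = \<one>\<^bsub>?P\<^esub>" by blast
  fix B assume "B \<in> carrier ?P"
  then obtain w where w: "w \<in> gwords S" and B: "B = pres_class S R w" by auto
  show "A \<otimes>\<^bsub>?P\<^esub> B \<in> carrier ?P"
    unfolding A B mult_presented_group[OF u w] using u w by simp
  fix C assume "C \<in> carrier ?P"
  then obtain z where z: "z \<in> gwords S" and C: "C = pres_class S R z" by auto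
  show "A \<otimes>\<^bsub>?P\<^esub> B \<otimes>\<^bsub>?P\<^esub> C = A \<otimes>\<^bsub>?P\<^esub> (B \<otimes>\<^bsub>?P\<^esub> C)"
    unfolding A B C by (simp add: u w z)
qed

lemma word_eval_simps [simp]:
  "word_eval G f [] = \<one>\<^bsub>G\<^esub>"
  "word_eval G f ((x, b) # w) =
    (if b then f x else inv\<^bsub>G\<^esub> (f x)) \<otimes>\<^bsub>G\<^esub> word_eval G f w"
  by (simp_all add: word_eval_def)

context group
begin

lemma word_eval_closed [simp]:
  "f \<in> S \<rightarrow> carrier G \<Longrightarrow> w \<in> gwords S \<Longrightarrow> word_eval G f w \<in> carrier G"
  by (induction w) (auto simp: Pi_iff)

lemma word_eval_append:
  "f \<in> S \<rightarrow> carrier G \<Longrightarrow> u \<in> gwords S \<Longrightarrow> w \<in> gwords S \<Longrightarrow>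
    word_eval G f (u @ w) = word_eval G f u \<otimes> word_eval G f w"
  by (induction u) (auto simp: Pi_iff m_assoc)

lemma word_eval_pres_eq:
  assumes f: "f \<in> S \<rightarrow> carrier G"
    and R: "\<And>r. r \<in> R \<Longrightarrow> r \<in> gwords S \<Longrightarrow> word_eval G f r = \<one>"
    and "pres_eq S R u w"
  shows "word_eval G f u = word_eval G f w"
proof -
  have word_eval_delete: "word_eval G f (u @ r @ w) = word_eval G f (u @ w)"
    if "u \<in> gwords S" "w \<in> gwords S" "r \<in> gwords S" "word_eval G f r = \<one>" for u w r
  proof -
    have "word_eval G f (r @ w) = word_eval G f w"
      unfolding word_eval_append[OF f that(3,2)] that(4)
      by (rule l_one[OF word_eval_closed[OF f that(2)]])
    moreover have "r @ w \<in> gwords S" using that by simp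
    ultimately show ?thesis using word_eval_append[OF f] that by metis
  qed
  from assms(3) show ?thesis
  proof (induction rule: pres_eq.induct)
    case (pres_cancel u w x b)
    have x: "f x \<in> carrier G" using f pres_cancel(3) by auto
    have "word_eval G f [(x, b), (x, \<not> b)] = \<one>" using x by (cases b) simp_all
    moreover have "[(x, b), (x, \<not> b)] \<in> gwords S" using pres_cancel(3) by simp
    ultimately show ?case
      using word_eval_delete pres_cancel(1,2) by blast
  next
    case (pres_relator u w r)
    then show ?case
      using word_eval_delete R by blast
  qed simp_all
qed

lemma pres_lift_class:
  assumes "f \<in> S \<rightarrow> carrier G"
    and "\<And>r. r \<in> R \<Longrightarrow> r \<in> gwords S \<Longrightarrow> word_eval G f r = \<one>"
    and "w \<in> gwords S"
  shows "pres_lift G f (pres_class S R w) = word_eval G f w"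
proof -
  have "word_eval G f w' = word_eval G f w" if "w' \<in> pres_class S R w" for w'
    using word_eval_pres_eq[OF assms(1,2)] that by (auto simp: pres_class_def)
  then have "word_eval G f ` pres_class S R w = {word_eval G f w}"
    using pres_class_self[OF assms(3)] by blast
  then show ?thesis by (simp add: pres_lift_def)
qed

lemma pres_lift_hom:
  assumes "f \<in> S \<rightarrow> carrier G"
    and "\<And>r. r \<in> R \<Longrightarrow> r \<in> gwords S \<Longrightarrow> word_eval G f r = \<one>"
  shows "pres_lift G f \<in> hom (presented_group S R) G"
  by (rule homI)
    (auto simp: pres_lift_class[OF assms] word_eval_append[OF assms(1)] word_eval_closed[OF assms(1)])

lemma pres_lift_gen:
  assumes "f \<in> S \<rightarrow> carrier G"
    and "\<And>r. r \<in> R \<Longrightarrow> r \<in> gwords S \<Longrightarrow> word_eval G f r = \<one>"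
    and "x \<in> S"
  shows "pres_lift G f (pres_gen S R x) = f x"
proof -
  have "f x \<in> carrier G" "[(x, True)] \<in> gwords S" using assms by auto
  then show ?thesis by (simp add: pres_gen_def pres_lift_class[OF assms(1,2)])
qed

end

lemma pres_class_inverse_letter:
  assumes "x \<in> S"
  shows "pres_class S R [(x, False)] = inv\<^bsub>presented_group S R\<^esub> pres_gen S R x"
proof -
  interpret P: group "presented_group S R" by (rule group_presented_group)
  have "pres_eq S R [(x, False), (x, True)] []"
    using pres_eq.pres_cancel[of "[]" S "[]" x R False] assms by simp
  then have "pres_class S R [(x, False)] \<otimes>\<^bsub>presented_group S R\<^esub> pres_gen S R x
      = \<one>\<^bsub>presented_group S R\<^esub>"
    using assms by (simp add: pres_gen_def pres_class_eq_iff)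
  then have "inv\<^bsub>presented_group S R\<^esub> pres_gen S R x = pres_class S R [(x, False)]"
    using assms by (intro P.inv_equality) (auto simp: pres_gen_def)
  then show ?thesis by simp
qed

lemma presented_group_hom_unique:
  assumes "group G" "h \<in> hom (presented_group S R) G" "h' \<in> hom (presented_group S R) G"
    and gen: "\<And>x. x \<in> S \<Longrightarrow> h (pres_gen S R x) = h' (pres_gen S R x)"
    and "A \<in> carrier (presented_group S R)"
  shows "h A = h' A"
proof -
  let ?P = "presented_group S R"
  interpret h: group_hom ?P G h
    using assms group_presented_group by (simp add: group_hom_def group_hom_axioms_def)
  interpret h': group_hom ?P G h'
    using assms group_presented_group by (simp add: group_hom_def group_hom_axioms_def)
  have letter: "h (pres_class S R [(x, b)]) = h' (pres_class S R [(x, b)])" if "x \<in> S" for x b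
  proof (cases b)
    case True
    then show ?thesis using gen that by (simp add: pres_gen_def)
  next
    case False
    have "pres_gen S R x \<in> carrier ?P" using that by (auto simp: pres_gen_def)
    then show ?thesis
      using False gen[OF that] that by (simp only: pres_class_inverse_letter h.hom_inv h'.hom_inv)
  qed
  have "h (pres_class S R w) = h' (pres_class S R w)" if "w \<in> gwords S" for w
    using that
  proof (induction w)
    case Nil
    then show ?case using h.hom_one h'.hom_one by simp
  next
    case (Cons p w)
    obtain x b where p: "p = (x, b)" by fastforce
    then have *: "pres_class S R (p # w) = pres_class S R [(x, b)] \<otimes>\<^bsub>?P\<^esub> pres_class S R w"
      using Cons.prems by simp
    have c: "pres_class S R [(x, b)] \<in> carrier ?P" "pres_class S R w \<in> carrier ?P"
      using Cons.prems p by auto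
    have "x \<in> S" and IH: "h (pres_class S R w) = h' (pres_class S R w)"
      using Cons p by simp_all
    then show ?case
      unfolding * h.hom_mult[OF c] h'.hom_mult[OF c] by (simp only: letter IH)
  qed
  then show ?thesis using assms(5) by auto
qed


text \<open>A finite simplicial graph is a \<^const>\<open>pair_graph\<close>: each edge \<open>{u, w}\<close> is
  represented by the two arcs \<open>(u, w)\<close> and \<open>(w, u)\<close>. The definition below is the
  cone only if \<open>v\<close> is not already a vertex of \<open>L\<close>.\<close>

definition cone :: "'a \<Rightarrow> 'a pair_pre_digraph \<Rightarrow> 'a pair_pre_digraph" where
  "cone v L =
    \<lparr>pverts = insert v (pverts L),
     parcs = parcs L \<union> {v} \<times> pverts L \<union> pverts L \<times> {v}\<rparr>"

definition comm_word :: "'a \<Rightarrow> 'a \<Rightarrow> 'a gword" where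
  "comm_word u w = [(u, True), (w, True), (u, False), (w, False)]"

definition raag_relators :: "'a pair_pre_digraph \<Rightarrow> 'a gword set" where
  "raag_relators \<Gamma> = {comm_word u w | u w. (u, w) \<in> parcs \<Gamma>}"

definition raag :: "'a pair_pre_digraph \<Rightarrow> 'a gword set monoid" where
  "raag \<Gamma> = presented_group (pverts \<Gamma>) (raag_relators \<Gamma>)"

definition raag_gen :: "'a pair_pre_digraph \<Rightarrow> 'a \<Rightarrow> 'a gword set" where
  "raag_gen \<Gamma> x = pres_gen (pverts \<Gamma>) (raag_relators \<Gamma>) x"

definition bb_hom :: "'a gword set \<Rightarrow> int" where
  "bb_hom = pres_lift integer_group (\<lambda>_. 1)"

definition bestvina_brady :: "'a pair_pre_digraph \<Rightarrow> 'a gword set monoid" where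
  "bestvina_brady \<Gamma> = (raag \<Gamma>)\<lparr>carrier := kernel (raag \<Gamma>) integer_group bb_hom\<rparr>"

lemma pair_graph_cone:
  assumes "pair_graph L" "v \<notin> pverts L"
  shows "pair_graph (cone v L)"
proof -
  interpret L: pair_graph L by fact
  have "sym (parcs L)"
    using L.pair_sym_arcs by (simp add: symmetric_def)
  then have "sym (parcs (cone v L))"
    by (auto simp: cone_def sym_def)
  then have "symmetric (cone v L)" by (simp add: symmetric_def)
  moreover have "e \<in> parcs L \<Longrightarrow> fst e \<in> pverts L \<and> snd e \<in> pverts L \<and> fst e \<noteq> snd e" for e
    using L.arc_fst_in_verts L.arc_snd_in_verts L.pair_no_loops by blast
  ultimately show ?thesis
    using assms(2) L.pair_finite_verts L.pair_finite_arcs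
    by unfold_locales (fastforce simp: cone_def)+
qed

lemma group_raag: "group (raag \<Gamma>)"
  by (simp add: raag_def group_presented_group)

lemma word_eval_comm_word_integer_group:
  "r \<in> raag_relators \<Gamma> \<Longrightarrow> word_eval integer_group (\<lambda>_. 1) r = \<one>\<^bsub>integer_group\<^esub>"
  by (auto simp: raag_relators_def comm_word_def)

text \<open>So \<^const>\<open>bb_hom\<close> is the unique homomorphism to the integers that sends
  every vertex generator to \<open>1\<close>.\<close>

lemma bb_hom_hom: "bb_hom \<in> hom (raag \<Gamma>) integer_group"
  unfolding bb_hom_def raag_def
  by (rule group.pres_lift_hom) (simp_all add: word_eval_comm_word_integer_group)

lemma bb_hom_gen: "x \<in> pverts \<Gamma> \<Longrightarrow> bb_hom (raag_gen \<Gamma> x) = 1"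
  unfolding bb_hom_def raag_gen_def
  by (rule group.pres_lift_gen) (simp_all add: word_eval_comm_word_integer_group)

lemma bb_hom_unique:
  assumes "h \<in> hom (raag \<Gamma>) integer_group" "\<And>x. x \<in> pverts \<Gamma> \<Longrightarrow> h (raag_gen \<Gamma> x) = 1"
    and "A \<in> carrier (raag \<Gamma>)"
  shows "h A = bb_hom A"
proof (rule presented_group_hom_unique[OF group_integer_group])
  show "h \<in> hom (presented_group (pverts \<Gamma>) (raag_relators \<Gamma>)) integer_group"
    "bb_hom \<in> hom (presented_group (pverts \<Gamma>) (raag_relators \<Gamma>)) integer_group"
    "A \<in> carrier (presented_group (pverts \<Gamma>) (raag_relators \<Gamma>))"
    using assms(1,3) bb_hom_hom[of \<Gamma>] by (simp_all only: raag_def)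
  show "h (pres_gen (pverts \<Gamma>) (raag_relators \<Gamma>) x)
      = bb_hom (pres_gen (pverts \<Gamma>) (raag_relators \<Gamma>) x)" if "x \<in> pverts \<Gamma>" for x
    using assms(2)[OF that] bb_hom_gen[OF that] by (simp only: raag_gen_def)
qed

lemma group_bestvina_brady: "group (bestvina_brady \<Gamma>)"
proof -
  interpret group_hom "raag \<Gamma>" integer_group bb_hom
    by (simp add: group_hom_def group_hom_axioms_def group_raag bb_hom_hom)
  show ?thesis
    unfolding bestvina_brady_def by (rule subgroup.subgroup_is_group[OF subgroup_kernel group_raag])
qed

end

(* Write t for the generator of the cone vertex v; it is central in the group A of the cone.
   Let p kill t and fix the other generators, and let q send each vertex x of the base graph to
   x t^(-1), which lies in the kernel of bb_hom. Then p q is the identity, and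
   g = q (p g) t^(bb_hom g) for all g in A, because both sides are homomorphisms in g that agree on
   the generators. Hence p and q are inverse to each other on the kernel. *)

theory Submission
  imports Defs
begin

lemma raag_gen_closed: "x \<in> pverts \<Gamma> \<Longrightarrow> raag_gen \<Gamma> x \<in> carrier (raag \<Gamma>)"
  by (simp add: raag_gen_def pres_gen_def raag_def)

text \<open>A homomorphism is determined on the vertex generators. Centrality and the identities for
  \<open>p\<close> and \<open>q\<close> below are all obtained by comparing two homomorphisms this
  way.\<close>

lemma raag_hom_unique:
  assumes "group G" "h \<in> hom (raag \<Gamma>) G" "h' \<in> hom (raag \<Gamma>) G"
    and "\<And>x. x \<in> pverts \<Gamma> \<Longrightarrow> h (raag_gen \<Gamma> x) = h' (raag_gen \<Gamma> x)"
    and "A \<in> carrier (raag \<Gamma>)"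
  shows "h A = h' A"
  using assms unfolding raag_def raag_gen_def by (rule presented_group_hom_unique)

lemma (in group) word_eval_comm_word:
  assumes "f u \<in> carrier G" "f w \<in> carrier G"
  shows "word_eval G f (comm_word u w) = \<one> \<longleftrightarrow> f u \<otimes> f w = f w \<otimes> f u"
proof -
  have "word_eval G f (comm_word u w) = (f u \<otimes> f w) \<otimes> inv (f w \<otimes> f u)"
    using assms by (simp add: comm_word_def m_assoc inv_mult_group)
  then show ?thesis
    using assms by (metis inv_closed inv_equality inv_inv m_closed r_inv)
qed

text \<open>Universal property, with only the values on generators exposed. The endpoints in
  \<open>comm\<close> may be assumed to be vertices because a relator counts only if it is a word
  over \<open>pverts \<Gamma>\<close>, whereas a bare \<open>pair_pre_digraph\<close> may have other
  arcs.\<close>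

lemma raag_lift:
  assumes "group G" "f \<in> pverts \<Gamma> \<rightarrow> carrier G"
    and comm: "\<And>u w. (u, w) \<in> parcs \<Gamma> \<Longrightarrow> u \<in> pverts \<Gamma> \<Longrightarrow> w \<in> pverts \<Gamma> \<Longrightarrow>
      f u \<otimes>\<^bsub>G\<^esub> f w = f w \<otimes>\<^bsub>G\<^esub> f u"
  obtains h where "h \<in> hom (raag \<Gamma>) G" "\<And>x. x \<in> pverts \<Gamma> \<Longrightarrow> h (raag_gen \<Gamma> x) = f x"
proof -
  interpret group G by fact
  have R: "word_eval G f r = \<one>\<^bsub>G\<^esub>" if r: "r \<in> raag_relators \<Gamma>" "r \<in> gwords (pverts \<Gamma>)" for r
  proof -
    obtain u w where uw: "(u, w) \<in> parcs \<Gamma>" "r = comm_word u w"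
      using r(1) by (auto simp: raag_relators_def)
    then have "u \<in> pverts \<Gamma>" "w \<in> pverts \<Gamma>" using r(2) by (auto simp: comm_word_def)
    then show ?thesis
      using assms(2) comm uw by (subst uw(2), subst word_eval_comm_word) auto
  qed
  show ?thesis
    using that pres_lift_hom[OF assms(2) R] pres_lift_gen[OF assms(2) R]
    unfolding raag_def raag_gen_def by blast
qed

text \<open>Append the word \<open>w u\<close> to the relator \<open>u w u^-1 w^-1\<close>: deleting
  the relator leaves \<open>w u\<close>, while cancelling inverse pairs leaves
  \<open>u w\<close>.\<close>

lemma raag_gen_commute:
  assumes "(u, w) \<in> parcs \<Gamma>" "u \<in> pverts \<Gamma>" "w \<in> pverts \<Gamma>"
  shows "raag_gen \<Gamma> u \<otimes>\<^bsub>raag \<Gamma>\<^esub> raag_gen \<Gamma> w = raag_gen \<Gamma> w \<otimes>\<^bsub>raag \<Gamma>\<^esub> raag_gen \<Gamma> u"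
proof -
  let ?S = "pverts \<Gamma>" and ?R = "raag_relators \<Gamma>"
  have "comm_word u w \<in> ?R" "comm_word u w \<in> gwords ?S"
    using assms by (auto simp: raag_relators_def comm_word_def)
  then have "pres_eq ?S ?R (comm_word u w) []"
    using pres_eq.pres_relator[of "[]" ?S "[]" "comm_word u w" ?R] by simp
  then have "pres_eq ?S ?R (comm_word u w @ [(w, True), (u, True)]) ([] @ [(w, True), (u, True)])"
    using assms by (intro pres_eq_append_right) auto
  then have 1: "pres_eq ?S ?R
      [(u, True), (w, True), (u, False), (w, False), (w, True), (u, True)] [(w, True), (u, True)]"
    by (simp add: comm_word_def)
  have 2: "pres_eq ?S ?R
      [(u, True), (w, True), (u, False), (w, False), (w, True), (u, True)]
      [(u, True), (w, True), (u, False), (u, True)]"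
    using assms pres_eq.pres_cancel[of "[(u, True), (w, True), (u, False)]" ?S "[(u, True)]" w ?R False]
    by simp
  have 3: "pres_eq ?S ?R
      [(u, True), (w, True), (u, False), (u, True)] [(u, True), (w, True)]"
    using assms pres_eq.pres_cancel[of "[(u, True), (w, True)]" ?S "[]" u ?R False]
    by simp
  have "pres_eq ?S ?R [(u, True), (w, True)] [(w, True), (u, True)]"
    using 1 2 3 by (meson pres_eq.pres_sym pres_eq.pres_trans)
  then show ?thesis
    using assms by (simp add: raag_def raag_gen_def pres_gen_def pres_class_eq_iff)
qed

text \<open>Conjugation by \<open>t\<close> is an endomorphism that fixes every generator, hence it
  is the identity.\<close>

lemma raag_central:
  assumes t: "t \<in> carrier (raag \<Gamma>)"
    and gen: "\<And>x. x \<in> pverts \<Gamma> \<Longrightarrow> t \<otimes>\<^bsub>raag \<Gamma>\<^esub> raag_gen \<Gamma> x = raag_gen \<Gamma> x \<otimes>\<^bsub>raag \<Gamma>\<^esub> t"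
    and A: "A \<in> carrier (raag \<Gamma>)"
  shows "t \<otimes>\<^bsub>raag \<Gamma>\<^esub> A = A \<otimes>\<^bsub>raag \<Gamma>\<^esub> t"
proof -
  interpret G: group "raag \<Gamma>" by (rule group_raag)
  let ?c = "\<lambda>A. t \<otimes>\<^bsub>raag \<Gamma>\<^esub> A \<otimes>\<^bsub>raag \<Gamma>\<^esub> inv\<^bsub>raag \<Gamma>\<^esub> t"
  have "?c A = id A"
  proof (rule raag_hom_unique[OF group_raag _ _ _ A])
    show "?c \<in> hom (raag \<Gamma>) (raag \<Gamma>)"
      using t by (intro homI) (simp_all add: G.m_assoc G.inv_solve_left)
    show "id \<in> hom (raag \<Gamma>) (raag \<Gamma>)" by (simp add: hom_def)
    show "?c (raag_gen \<Gamma> x) = id (raag_gen \<Gamma> x)" if "x \<in> pverts \<Gamma>" for x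
      using t raag_gen_closed[OF that] by (simp add: gen[OF that] G.m_assoc)
  qed
  then show ?thesis
    using t A by (simp add: G.inv_solve_right')
qed

text \<open>The apex is joined to every other vertex, so its generator commutes with all
  generators.\<close>

lemma cone_apex_central:
  assumes "A \<in> carrier (raag (cone v L))"
  shows "raag_gen (cone v L) v \<otimes>\<^bsub>raag (cone v L)\<^esub> A = A \<otimes>\<^bsub>raag (cone v L)\<^esub> raag_gen (cone v L) v"
proof (rule raag_central[OF _ _ assms])
  show "raag_gen (cone v L) v \<in> carrier (raag (cone v L))"
    by (rule raag_gen_closed) (simp add: cone_def)
  show "raag_gen (cone v L) v \<otimes>\<^bsub>raag (cone v L)\<^esub> raag_gen (cone v L) x =
      raag_gen (cone v L) x \<otimes>\<^bsub>raag (cone v L)\<^esub> raag_gen (cone v L) v"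
    if "x \<in> pverts (cone v L)" for x
  proof (cases "x = v")
    case False
    then show ?thesis
      using that by (intro raag_gen_commute) (auto simp: cone_def)
  qed simp
qed

text \<open>Negative exponents matter: \<open>q\<close> involves the power -1, and
  \<open>bb_hom\<close> takes negative values.\<close>

lemma (in group) central_int_pow:
  assumes "t \<in> carrier G" "A \<in> carrier G" "t \<otimes> A = A \<otimes> t"
  shows "t [^] (n::int) \<otimes> A = A \<otimes> t [^] n"
proof -
  have nat: "t [^] k \<otimes> A = A \<otimes> t [^] k" for k :: nat
  proof (induction k)
    case (Suc k)
    have "t [^] Suc k \<otimes> A = t [^] k \<otimes> A \<otimes> t"
      using assms by (simp add: m_assoc)
    then show ?case using assms by (simp add: Suc m_assoc)
  qed (use assms in simp)
  have "inv (t [^] k) \<otimes> A = A \<otimes> inv (t [^] k)" for k :: nat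
  proof -
    \<comment> \<open>Both sides of the goal become \<open>A\<close> after multiplication by
      \<open>t [^] k\<close> on the left, which can be cancelled.\<close>
    have "t [^] k \<otimes> (A \<otimes> inv (t [^] k)) = t [^] k \<otimes> A \<otimes> inv (t [^] k)"
      using assms by (simp add: m_assoc)
    also have "\<dots> = A" using assms by (simp add: nat m_assoc)
    finally show ?thesis using assms by (simp add: inv_solve_left')
  qed
  then show ?thesis
    by (cases "n < 0") (simp_all only: int_pow_def2 nat if_True if_False)
qed

theorem corollary3p10:
  fixes \<Lambda> \<Gamma> :: "'a pair_pre_digraph" and v :: 'a
  assumes "pair_graph \<Lambda>"
    and "v \<notin> pverts \<Lambda>"
    and "\<Gamma> = cone v \<Lambda>"
  shows "bestvina_brady \<Gamma> \<cong> raag \<Lambda>"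
proof -
  let ?G = "raag \<Gamma>" and ?L = "raag \<Lambda>"
  interpret G: group ?G by (rule group_raag)
  interpret L: group ?L by (rule group_raag)
  have verts: "pverts \<Gamma> = insert v (pverts \<Lambda>)" by (simp add: assms(3) cone_def)
  have arcs: "(u, w) \<in> parcs \<Gamma> \<Longrightarrow> u \<noteq> v \<Longrightarrow> w \<noteq> v \<Longrightarrow> (u, w) \<in> parcs \<Lambda>"
    "(u, w) \<in> parcs \<Lambda> \<Longrightarrow> (u, w) \<in> parcs \<Gamma>" for u w
    by (auto simp: assms(3) cone_def)
  define t where "t = raag_gen \<Gamma> v"
  have t: "t \<in> carrier ?G" unfolding t_def by (rule raag_gen_closed) (simp add: verts)
  have central: "t [^]\<^bsub>?G\<^esub> (n::int) \<otimes>\<^bsub>?G\<^esub> A = A \<otimes>\<^bsub>?G\<^esub> t [^]\<^bsub>?G\<^esub> n"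
    if "A \<in> carrier ?G" for A n
    using that t cone_apex_central[of A v \<Lambda>] unfolding assms(3) t_def
    by (intro group.central_int_pow group_raag)
  \<comment> \<open>Normal form for products: since \<open>t\<close> is central, its powers gather
    on the right and their exponents add.\<close>
  have t_swap: "A \<otimes>\<^bsub>?G\<^esub> t [^]\<^bsub>?G\<^esub> (m::int) \<otimes>\<^bsub>?G\<^esub> (B \<otimes>\<^bsub>?G\<^esub> t [^]\<^bsub>?G\<^esub> (n::int)) =
      (A \<otimes>\<^bsub>?G\<^esub> B) \<otimes>\<^bsub>?G\<^esub> t [^]\<^bsub>?G\<^esub> (m + n)"
    if "A \<in> carrier ?G" "B \<in> carrier ?G" for A B m n
  proof -
    have "t [^]\<^bsub>?G\<^esub> m \<otimes>\<^bsub>?G\<^esub> (B \<otimes>\<^bsub>?G\<^esub> t [^]\<^bsub>?G\<^esub> n) = B \<otimes>\<^bsub>?G\<^esub> t [^]\<^bsub>?G\<^esub> (m + n)"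
      using that t central[OF that(2), of m]
      by (simp add: G.int_pow_mult flip: G.m_assoc)
    then show ?thesis using that t by (simp add: G.m_assoc)
  qed

  obtain p where p: "p \<in> hom ?G ?L"
    and p_gen: "\<And>x. x \<in> pverts \<Gamma> \<Longrightarrow> p (raag_gen \<Gamma> x) = (if x = v then \<one>\<^bsub>?L\<^esub> else raag_gen \<Lambda> x)"
  proof (rule raag_lift[OF group_raag])
    show "(\<lambda>x. if x = v then \<one>\<^bsub>?L\<^esub> else raag_gen \<Lambda> x) \<in> pverts \<Gamma> \<rightarrow> carrier ?L"
      by (auto simp: verts raag_gen_closed)
  next
    fix u w assume "(u, w) \<in> parcs \<Gamma>" "u \<in> pverts \<Gamma>" "w \<in> pverts \<Gamma>"
    \<comment> \<open>An arc at \<open>v\<close> asks only that something commute with the identity;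
      any other arc already lies in \<Lambda>.\<close>
    then show "(if u = v then \<one>\<^bsub>?L\<^esub> else raag_gen \<Lambda> u) \<otimes>\<^bsub>?L\<^esub> (if w = v then \<one>\<^bsub>?L\<^esub> else raag_gen \<Lambda> w) =
        (if w = v then \<one>\<^bsub>?L\<^esub> else raag_gen \<Lambda> w) \<otimes>\<^bsub>?L\<^esub> (if u = v then \<one>\<^bsub>?L\<^esub> else raag_gen \<Lambda> u)"
      using raag_gen_closed[of _ \<Lambda>] raag_gen_commute[OF arcs(1), of u w] by (auto simp: verts)
  qed blast
  obtain q where q: "q \<in> hom ?L ?G"
    \<comment> \<open>The inverse of \<open>t\<close> is written as an integer power so that
      \<open>t_swap\<close> applies to these images.\<close>
    and q_gen: "\<And>x. x \<in> pverts \<Lambda> \<Longrightarrow> q (raag_gen \<Lambda> x) = raag_gen \<Gamma> x \<otimes>\<^bsub>?G\<^esub> t [^]\<^bsub>?G\<^esub> (-1::int)"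
  proof (rule raag_lift[OF group_raag])
    show "(\<lambda>x. raag_gen \<Gamma> x \<otimes>\<^bsub>?G\<^esub> t [^]\<^bsub>?G\<^esub> (-1::int)) \<in> pverts \<Lambda> \<rightarrow> carrier ?G"
      using t by (auto simp: verts raag_gen_closed)
  next
    fix u w assume "(u, w) \<in> parcs \<Lambda>" "u \<in> pverts \<Lambda>" "w \<in> pverts \<Lambda>"
    then show "raag_gen \<Gamma> u \<otimes>\<^bsub>?G\<^esub> t [^]\<^bsub>?G\<^esub> (-1::int) \<otimes>\<^bsub>?G\<^esub> (raag_gen \<Gamma> w \<otimes>\<^bsub>?G\<^esub> t [^]\<^bsub>?G\<^esub> (-1::int)) =
        raag_gen \<Gamma> w \<otimes>\<^bsub>?G\<^esub> t [^]\<^bsub>?G\<^esub> (-1::int) \<otimes>\<^bsub>?G\<^esub> (raag_gen \<Gamma> u \<otimes>\<^bsub>?G\<^esub> t [^]\<^bsub>?G\<^esub> (-1::int))"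
      by (simp add: t_swap raag_gen_closed verts raag_gen_commute[OF arcs(2), of u w])
  qed blast
  interpret p: group_hom ?G ?L p
    by (simp add: group_hom_def group_hom_axioms_def group_raag p)
  interpret q: group_hom ?L ?G q
    by (simp add: group_hom_def group_hom_axioms_def group_raag q)
  interpret b: group_hom ?G integer_group bb_hom
    by (simp add: group_hom_def group_hom_axioms_def group_raag bb_hom_hom)
  \<comment> \<open>On powers of \<open>t\<close>, \<open>p\<close> is trivial and
    \<open>bb_hom\<close> reads off the exponent.\<close>
  have t_pow: "p (t [^]\<^bsub>?G\<^esub> n) = \<one>\<^bsub>?L\<^esub>" "bb_hom (t [^]\<^bsub>?G\<^esub> n) = n" for n :: int
    using t p_gen[of v] bb_hom_gen[of v \<Gamma>]
    by (simp_all add: p.hom_int_pow b.hom_int_pow verts flip: t_def)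

  have pq: "p (q A) = A" if A: "A \<in> carrier ?L" for A
  proof -
    have "(p \<circ> q) A = id A"
    proof (rule raag_hom_unique[OF group_raag _ _ _ A])
      show "p \<circ> q \<in> hom ?L ?L" by (rule hom_compose[OF q p])
      show "id \<in> hom ?L ?L" by (simp add: hom_def)
      \<comment> \<open>Freshness of \<open>v\<close> enters here: it gives
        \<open>x \<noteq> v\<close>, so \<open>p\<close> keeps \<open>x\<close> and kills only the
        factor \<open>t^-1\<close>.\<close>
      show "(p \<circ> q) (raag_gen \<Lambda> x) = id (raag_gen \<Lambda> x)" if "x \<in> pverts \<Lambda>" for x
        using that assms(2) t t_pow raag_gen_closed[of x \<Lambda>] raag_gen_closed[of x \<Gamma>]
        by (auto simp: q_gen p_gen verts)
    qed
    then show ?thesis by simp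
  qed
  have bq: "bb_hom (q A) = 0" if A: "A \<in> carrier ?L" for A
  proof -
    have "(bb_hom \<circ> q) A = (\<lambda>_. 0) A"
    proof (rule raag_hom_unique[OF group_integer_group _ _ _ A])
      show "bb_hom \<circ> q \<in> hom ?L integer_group" by (rule hom_compose[OF q bb_hom_hom])
      show "(\<lambda>_. 0) \<in> hom ?L integer_group" by (simp add: hom_def)
      \<comment> \<open>The exponent sum of \<open>x t^-1\<close> is 1 - 1.\<close>
      show "(bb_hom \<circ> q) (raag_gen \<Lambda> x) = 0" if "x \<in> pverts \<Lambda>" for x
        using that t t_pow raag_gen_closed[of x \<Gamma>]
        by (simp add: q_gen verts bb_hom_gen)
    qed
    then show ?thesis by simp
  qed
  have qp: "q (p A) \<otimes>\<^bsub>?G\<^esub> t [^]\<^bsub>?G\<^esub> bb_hom A = A" if A: "A \<in> carrier ?G" for A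
  proof -
    have "(\<lambda>A. q (p A) \<otimes>\<^bsub>?G\<^esub> t [^]\<^bsub>?G\<^esub> bb_hom A) A = id A"
    proof (rule raag_hom_unique[OF group_raag _ _ _ A])
      \<comment> \<open>Multiplicativity is \<open>t_swap\<close>, as \<open>bb_hom\<close> turns
        products into sums of exponents.\<close>
      show "(\<lambda>A. q (p A) \<otimes>\<^bsub>?G\<^esub> t [^]\<^bsub>?G\<^esub> bb_hom A) \<in> hom ?G ?G"
        using t by (intro homI) (simp_all add: t_swap)
      show "id \<in> hom ?G ?G" by (simp add: hom_def)
      show "q (p (raag_gen \<Gamma> x)) \<otimes>\<^bsub>?G\<^esub> t [^]\<^bsub>?G\<^esub> bb_hom (raag_gen \<Gamma> x) = id (raag_gen \<Gamma> x)"
        if "x \<in> pverts \<Gamma>" for x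
      proof (cases "x = v")
        case True
        then show ?thesis using t that p_gen[of v] bb_hom_gen[of v \<Gamma>] by (simp flip: t_def)
      next
        case False
        then show ?thesis
          \<comment> \<open>With \<open>B\<close> the identity, \<open>t_swap\<close> reduces
            \<open>x t^-1 t\<close> to \<open>x\<close>.\<close>
          using t that raag_gen_closed[OF that] t_swap[of "raag_gen \<Gamma> x" "\<one>\<^bsub>?G\<^esub>" "-1" 1]
          by (simp add: p_gen bb_hom_gen q_gen verts)
      qed
    qed
    then show ?thesis by simp
  qed

  have carrier: "carrier (bestvina_brady \<Gamma>) = {A \<in> carrier ?G. bb_hom A = 0}"
    by (simp add: bestvina_brady_def kernel_def)
  \<comment> \<open>The kernel inherits the multiplication of the ambient group, so \<open>p\<close>
    merely has to be restricted.\<close>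
  have "p \<in> hom (bestvina_brady \<Gamma>) ?L"
    unfolding hom_def carrier by (auto simp: bestvina_brady_def)
  moreover have "bij_betw p (carrier (bestvina_brady \<Gamma>)) (carrier ?L)"
  proof (rule bij_betw_byWitness[where f' = q])
    show "\<forall>A\<in>carrier (bestvina_brady \<Gamma>). q (p A) = A"
    proof
      fix A assume "A \<in> carrier (bestvina_brady \<Gamma>)"
      \<comment> \<open>On the kernel the exponent \<open>bb_hom A\<close> is 0, so the factor in
        \<open>t\<close> disappears from \<open>qp\<close>.\<close>
      then show "q (p A) = A" using qp[of A] by (simp add: carrier)
    qed
  qed (use pq bq in \<open>auto simp: carrier\<close>)
  ultimately show ?thesis
    unfolding is_iso_def iso_def by blast
qed

end
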